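(* For every $n\ge 2$, all the ideals of the Lie algebra $\mathfrak{u}_n$ are characteristic ideals, i.e. $\sigma(I)=I$ for every ideal $I$ of $\mathfrak{u}_n$ and every $K$-automorphism $\sigma$ of the Lie algebra $\mathfrak{u}_n$.
   Context: $K$ is a field of characteristic zero, $P_0=K$, $P_i=K[x_1,\ldots,x_i]$, $\partial_i=\partial/\partial x_i$. For $n\ge 2$, $\mathfrak{u}_n=K\partial_1+P_1\partial_2+\cdots+P_{n-1}\partial_n$, a Lie subalgebra of $\mathrm{Der}_K(P_n)$. *)

theory Defs
  imports Complex_Main "HOL-Library.Poly_Mapping" "HOL-Library.Function_Algebras"
begin

section \<open>Lie algebras, ideals and automorphisms\<close>

text \<open>A Lie algebra over the field \<open>'k\<close> whose underlying space is a subspace \<open>L\<close> of an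
  ambient vector space. Only the values of the bracket on \<open>L\<close> matter.\<close>

locale lie_algebra = vector_space scale
  for scale :: "'k::field \<Rightarrow> 'v::ab_group_add \<Rightarrow> 'v" +
  fixes bracket :: "'v \<Rightarrow> 'v \<Rightarrow> 'v" and L :: "'v set"
  assumes subspace_L: "subspace L"
    and bracket_closed: "\<lbrakk>x \<in> L; y \<in> L\<rbrakk> \<Longrightarrow> bracket x y \<in> L"
    and bracket_add_left:
      "\<lbrakk>x \<in> L; y \<in> L; z \<in> L\<rbrakk> \<Longrightarrow> bracket (x + y) z = bracket x z + bracket y z"
    and bracket_add_right:
      "\<lbrakk>x \<in> L; y \<in> L; z \<in> L\<rbrakk> \<Longrightarrow> bracket x (y + z) = bracket x y + bracket x z"
    and bracket_scale_left:
      "\<lbrakk>x \<in> L; y \<in> L\<rbrakk> \<Longrightarrow> bracket (scale c x) y = scale c (bracket x y)"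
    and bracket_scale_right:
      "\<lbrakk>x \<in> L; y \<in> L\<rbrakk> \<Longrightarrow> bracket x (scale c y) = scale c (bracket x y)"
    and bracket_self: "x \<in> L \<Longrightarrow> bracket x x = 0"
    and jacobi: "\<lbrakk>x \<in> L; y \<in> L; z \<in> L\<rbrakk> \<Longrightarrow>
      bracket x (bracket y z) + bracket y (bracket z x) + bracket z (bracket x y) = 0"
begin

definition lie_ideal :: "'v set \<Rightarrow> bool" where
  "lie_ideal I \<longleftrightarrow> I \<subseteq> L \<and> subspace I \<and> (\<forall>x\<in>L. \<forall>y\<in>I. bracket x y \<in> I)"

text \<open>Automorphisms are constrained only on \<open>L\<close>; their values elsewhere are irrelevant.\<close>

definition lie_automorphism :: "('v \<Rightarrow> 'v) \<Rightarrow> bool" where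
  "lie_automorphism \<sigma> \<longleftrightarrow> bij_betw \<sigma> L L
     \<and> (\<forall>x\<in>L. \<forall>y\<in>L. \<sigma> (x + y) = \<sigma> x + \<sigma> y)
     \<and> (\<forall>c. \<forall>x\<in>L. \<sigma> (scale c x) = scale c (\<sigma> x))
     \<and> (\<forall>x\<in>L. \<forall>y\<in>L. \<sigma> (bracket x y) = bracket (\<sigma> x) (\<sigma> y))"

definition characteristic_ideal :: "'v set \<Rightarrow> bool" where
  "characteristic_ideal I \<longleftrightarrow> lie_ideal I \<and> (\<forall>\<sigma>. lie_automorphism \<sigma> \<longrightarrow> \<sigma> ` I = I)"

end


section \<open>Polynomials\<close>

text \<open>Polynomials in the variables \<open>x\<^sub>i\<close>, \<open>i :: nat\<close>: a monomial is its finitely supported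
  exponent function, a polynomial a finitely supported function from monomials to coefficients,
  with the convolution product.\<close>

type_synonym 'k mpoly = "(nat \<Rightarrow>\<^sub>0 nat) \<Rightarrow>\<^sub>0 'k"

abbreviation mconst :: "'k::comm_ring_1 \<Rightarrow> 'k mpoly" where
  "mconst c \<equiv> Poly_Mapping.single 0 c"

definition polys :: "nat \<Rightarrow> 'k::comm_ring_1 mpoly set" where
  "polys i = {p. \<forall>m\<in>Poly_Mapping.keys p. Poly_Mapping.keys m \<subseteq> {1..i}}"

text \<open>On monomials, \<open>c x\<^sup>m\<close> is sent to \<open>m\<^sub>i c x\<^bsup>m - e\<^sub>i\<^esup>\<close>; the truncated exponent that arises for
  \<open>m\<^sub>i = 0\<close> comes with coefficient \<open>0\<close>.\<close>

definition partial_deriv :: "nat \<Rightarrow> 'k::comm_ring_1 mpoly \<Rightarrow> 'k mpoly" where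
  "partial_deriv i p = (\<Sum>m\<in>Poly_Mapping.keys p.
     Poly_Mapping.single (m - Poly_Mapping.single i 1)
       (of_nat (Poly_Mapping.lookup m i) * Poly_Mapping.lookup p m))"


section \<open>The Lie algebra of derivations and its subalgebra \<open>\<uu> n\<close>\<close>

text \<open>A map \<open>P\<^sub>n \<rightarrow> P\<^sub>n\<close> is represented by its extension by \<open>0\<close> to all polynomials, so that distinct
  maps on \<open>P\<^sub>n\<close> are distinct functions and conversely.\<close>

definition derivations :: "nat \<Rightarrow> ('k::comm_ring_1 mpoly \<Rightarrow> 'k mpoly) set" where
  "derivations n = {D.
     (\<forall>p. p \<notin> polys n \<longrightarrow> D p = 0)
     \<and> (\<forall>p\<in>polys n. D p \<in> polys n)
     \<and> (\<forall>p\<in>polys n. \<forall>q\<in>polys n. D (p + q) = D p + D q)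
     \<and> (\<forall>c. \<forall>p\<in>polys n. D (mconst c * p) = mconst c * D p)
     \<and> (\<forall>p\<in>polys n. \<forall>q\<in>polys n. D (p * q) = D p * q + p * D q)}"

definition op_scale :: "'k::comm_ring_1 \<Rightarrow> ('k mpoly \<Rightarrow> 'k mpoly) \<Rightarrow> ('k mpoly \<Rightarrow> 'k mpoly)" where
  "op_scale c D = (\<lambda>p. mconst c * D p)"

definition commutator ::
  "('k::comm_ring_1 mpoly \<Rightarrow> 'k mpoly) \<Rightarrow> ('k mpoly \<Rightarrow> 'k mpoly) \<Rightarrow> ('k mpoly \<Rightarrow> 'k mpoly)" where
  "commutator D E = (\<lambda>p. D (E p) - E (D p))"

definition partial_on :: "nat \<Rightarrow> nat \<Rightarrow> 'k::comm_ring_1 mpoly \<Rightarrow> 'k mpoly" where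
  "partial_on n i p = (if p \<in> polys n then partial_deriv i p else 0)"

definition \<uu> :: "nat \<Rightarrow> ('k::comm_ring_1 mpoly \<Rightarrow> 'k mpoly) set" where
  "\<uu> n = {(\<lambda>p. \<Sum>i\<in>{1..n}. a i * partial_on n i p) | a. \<forall>i\<in>{1..n}. a i \<in> polys (i - 1)}"


subsection \<open>Polynomial rings and partial derivatives\<close>

lemma polys_mono: "p \<in> polys i \<Longrightarrow> i \<le> j \<Longrightarrow> p \<in> polys j"
  unfolding polys_def by (force simp: subset_iff)

lemma polys_0 [simp]: "0 \<in> polys i"
  by (simp add: polys_def)

lemma polys_const [simp]: "mconst c \<in> polys i"
  by (simp add: polys_def)

lemma polys_add: "p \<in> polys i \<Longrightarrow> q \<in> polys i \<Longrightarrow> p + q \<in> polys i"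
  unfolding polys_def using Poly_Mapping.keys_add[of p q] by blast

lemma polys_mult: "p \<in> polys i \<Longrightarrow> q \<in> polys i \<Longrightarrow> p * q \<in> polys i"
  unfolding polys_def
  using keys_mult[of p q] Poly_Mapping.keys_add[where ?'b = nat and ?'a = nat] by blast

lemma polys_uminus: "p \<in> polys i \<Longrightarrow> - p \<in> polys i"
  unfolding polys_def by (simp add: in_keys_iff)

lemma polys_diff: "p \<in> polys i \<Longrightarrow> q \<in> polys i \<Longrightarrow> p - q \<in> polys i"
  using polys_add[of p i "- q"] polys_uminus[of q i] by simp

lemma polys_sum: "(\<And>x. x \<in> A \<Longrightarrow> f x \<in> polys i) \<Longrightarrow> (\<Sum>x\<in>A. f x) \<in> polys i"
  by (induction A rule: infinite_finite_induct) (auto intro: polys_add)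

lemma lookup_partial_deriv:
  "Poly_Mapping.lookup (partial_deriv i p) m =
     of_nat (Suc (Poly_Mapping.lookup m i)) *
     Poly_Mapping.lookup p (m + Poly_Mapping.single i 1)"
proof -
  let ?e = "Poly_Mapping.single i (1::nat)"
  have *: "Poly_Mapping.lookup (Poly_Mapping.single (k - ?e)
       (of_nat (Poly_Mapping.lookup k i) * Poly_Mapping.lookup p k)) m =
     (if k = m + ?e then of_nat (Suc (Poly_Mapping.lookup m i)) * Poly_Mapping.lookup p k else 0)"
    for k
  proof (cases "Poly_Mapping.lookup k i = 0")
    case True
    then have "k \<noteq> m + ?e" by (auto simp: lookup_add)
    with True show ?thesis by simp
  next
    case False
    then have "k - ?e + ?e = k"
      by (intro poly_mapping_eqI) (auto simp: lookup_add lookup_minus lookup_single when_def)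
    then have "k - ?e = m \<longleftrightarrow> k = m + ?e" by auto
    then show ?thesis by (auto simp: lookup_single when_def lookup_add)
  qed
  show ?thesis
    unfolding partial_deriv_def lookup_sum * by (simp add: in_keys_iff)
qed

lemma partial_deriv_single:
  "partial_deriv i (Poly_Mapping.single m c) =
     Poly_Mapping.single (m - Poly_Mapping.single i 1) (of_nat (Poly_Mapping.lookup m i) * c)"
  by (cases "c = 0") (simp_all add: partial_deriv_def)

lemma partial_deriv_0 [simp]: "partial_deriv i 0 = 0"
  by (simp add: partial_deriv_def)

lemma partial_deriv_add: "partial_deriv i (p + q) = partial_deriv i p + partial_deriv i q"
  by (rule poly_mapping_eqI) (simp only: lookup_partial_deriv lookup_add distrib_left)

lemma partial_deriv_sum: "partial_deriv i (\<Sum>x\<in>A. f x) = (\<Sum>x\<in>A. partial_deriv i (f x))"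
  by (induction A rule: infinite_finite_induct) (auto simp: partial_deriv_add)

lemma mpoly_sum_singles:
  "p = (\<Sum>m\<in>Poly_Mapping.keys p. Poly_Mapping.single m (Poly_Mapping.lookup p m))"
  by (rule poly_mapping_eqI) (simp add: lookup_sum lookup_single when_def in_keys_iff)

lemma partial_deriv_mult_single:
  fixes c d :: "'k::comm_ring_1" and m k :: "nat \<Rightarrow>\<^sub>0 nat"
  defines "S \<equiv> \<lambda>m c. Poly_Mapping.single m c :: 'k mpoly"
  shows "partial_deriv i (S m c * S k d) = partial_deriv i (S m c) * S k d + S m c * partial_deriv i (S k d)"
proof -
  let ?e = "Poly_Mapping.single i (1::nat)"
  have sh: "a - ?e + b = a + b - ?e" if "Poly_Mapping.lookup a i \<noteq> 0" for a b
    using that by (intro poly_mapping_eqI) (auto simp: lookup_add lookup_minus lookup_single when_def)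
  have l: "S (m - ?e + k) (of_nat (Poly_Mapping.lookup m i) * c * d)
      = S (m + k - ?e) (of_nat (Poly_Mapping.lookup m i) * c * d)"
    by (cases "Poly_Mapping.lookup m i = 0") (auto simp: S_def sh simp del: One_nat_def)
  have r: "S (m + (k - ?e)) (c * (of_nat (Poly_Mapping.lookup k i) * d))
      = S (m + k - ?e) (c * (of_nat (Poly_Mapping.lookup k i) * d))"
    using sh[of k m] by (cases "Poly_Mapping.lookup k i = 0") (simp_all add: S_def add.commute[of m])
  show ?thesis
    using l r unfolding S_def
    by (simp add: partial_deriv_single mult_single lookup_add single_add[symmetric] algebra_simps)
qed

lemma partial_deriv_mult: "partial_deriv i (p * q) = partial_deriv i p * q + p * partial_deriv i q"
proof -
  have 1: "partial_deriv i (Poly_Mapping.single m c * q) =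
      partial_deriv i (Poly_Mapping.single m c) * q + Poly_Mapping.single m c * partial_deriv i q" for m c
    apply (subst (1 2 3) mpoly_sum_singles[of q])
    by (simp only: partial_deriv_sum sum_distrib_left partial_deriv_mult_single sum.distrib)
  show ?thesis
    apply (subst (1 2 3) mpoly_sum_singles[of p])
    by (simp only: partial_deriv_sum sum_distrib_right 1 sum.distrib)
qed

lemma partial_deriv_const [simp]: "partial_deriv i (mconst c) = 0"
  by (simp add: partial_deriv_single)

lemma partial_deriv_commute: "partial_deriv i (partial_deriv j p) = partial_deriv j (partial_deriv i p)"
  by (cases "i = j", simp, rule poly_mapping_eqI)
     (simp add: lookup_partial_deriv lookup_add lookup_single when_def add.assoc add.commute
       mult.left_commute add.left_commute del: of_nat_Suc)

lemma polys_partial_deriv: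
  assumes "p \<in> polys j" shows "partial_deriv i p \<in> polys j"
  unfolding polys_def
proof (clarify)
  fix m k assume "m \<in> Poly_Mapping.keys (partial_deriv i p)" and k: "k \<in> Poly_Mapping.keys m"
  then have "m + Poly_Mapping.single i 1 \<in> Poly_Mapping.keys p"
    by (auto simp: in_keys_iff lookup_partial_deriv simp del: of_nat_Suc)
  moreover have "k \<in> Poly_Mapping.keys (m + Poly_Mapping.single i 1)"
    using k by (auto simp: in_keys_iff lookup_add)
  ultimately show "k \<in> {1..j}" using assms unfolding polys_def by blast
qed

lemma partial_deriv_eq_0:
  assumes "p \<in> polys j" "j < i" shows "partial_deriv i p = 0"
proof (rule poly_mapping_eqI)
  fix m :: "nat \<Rightarrow>\<^sub>0 nat"
  have "i \<in> Poly_Mapping.keys (m + Poly_Mapping.single i 1)"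
    by (auto simp: in_keys_iff lookup_add)
  then have "m + Poly_Mapping.single i 1 \<notin> Poly_Mapping.keys p"
    using assms unfolding polys_def by fastforce
  then show "Poly_Mapping.lookup (partial_deriv i p) m = Poly_Mapping.lookup 0 m"
    by (simp add: lookup_partial_deriv in_keys_iff)
qed


subsection \<open>\<open>\<uu> n\<close> is a Lie subalgebra of the derivations\<close>

lemma vector_space_op_scale: "vector_space (op_scale :: 'k::field \<Rightarrow> _)"
  by standard
     (auto simp: op_scale_def fun_eq_iff algebra_simps single_add mult_single mult.assoc[symmetric])

lemma derivations_eq_0: "D \<in> derivations n \<Longrightarrow> p \<notin> polys n \<Longrightarrow> D p = 0"
  and derivations_closed: "D \<in> derivations n \<Longrightarrow> p \<in> polys n \<Longrightarrow> D p \<in> polys n"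
  and derivations_add: "D \<in> derivations n \<Longrightarrow> p \<in> polys n \<Longrightarrow> q \<in> polys n \<Longrightarrow> D (p + q) = D p + D q"
  and derivations_scale: "D \<in> derivations n \<Longrightarrow> p \<in> polys n \<Longrightarrow> D (mconst c * p) = mconst c * D p"
  and derivations_mult:
    "D \<in> derivations n \<Longrightarrow> p \<in> polys n \<Longrightarrow> q \<in> polys n \<Longrightarrow> D (p * q) = D p * q + p * D q"
  unfolding derivations_def by blast+

lemma derivations_0: "D \<in> derivations n \<Longrightarrow> D 0 = 0"
  using derivations_add[of D n 0 0] by simp

lemma derivations_diff:
  "D \<in> derivations n \<Longrightarrow> p \<in> polys n \<Longrightarrow> q \<in> polys n \<Longrightarrow> D (p - q) = D p - D q"
  using derivations_add[of D n "p - q" q] by (simp add: polys_diff)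

lemma derivations_closed': "D \<in> derivations n \<Longrightarrow> D p \<in> polys n"
  by (cases "p \<in> polys n") (auto simp: derivations_eq_0 derivations_closed)

lemma commutator_derivations:
  assumes D: "D \<in> derivations n" and E: "E \<in> derivations n"
  shows "commutator D E \<in> derivations n"
proof -
  have "commutator D E (mconst c * p) = mconst c * commutator D E p" if "p \<in> polys n" for c p
    using D E that
    by (simp add: commutator_def derivations_scale[of _ n] derivations_closed' right_diff_distrib)
  moreover have "commutator D E p = 0" if "p \<notin> polys n" for p
    using D E that by (simp add: commutator_def derivations_eq_0[of _ n] derivations_0[of _ n])
  moreover have "commutator D E p \<in> polys n" for p
    using D E by (simp add: commutator_def polys_diff derivations_closed')
  moreover have "commutator D E (p + q) = commutator D E p + commutator D E q"
      "commutator D E (p * q) = commutator D E p * q + p * commutator D E q"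
    if "p \<in> polys n" "q \<in> polys n" for p q
    using D E that
    by (simp_all add: commutator_def derivations_closed' derivations_add[of _ n]
        derivations_mult[of _ n] polys_mult algebra_simps)
  ultimately show ?thesis
    by (simp add: derivations_def)
qed

lemma lie_algebra_sub_derivations:
  fixes L :: "('k::field mpoly \<Rightarrow> 'k mpoly) set"
  assumes L: "L \<subseteq> derivations n" and sub: "module.subspace op_scale L"
    and closed: "\<And>D E. D \<in> L \<Longrightarrow> E \<in> L \<Longrightarrow> commutator D E \<in> L"
  shows "lie_algebra op_scale commutator L"
proof -
  interpret vector_space "op_scale :: 'k \<Rightarrow> _" by (rule vector_space_op_scale)
  have der: "D \<in> derivations n" if "D \<in> L" for D using that L by blast
  have z: "D 0 = 0" if "D \<in> L" for D using derivations_0[OF der[OF that]] .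
  have sc: "D (mconst c * E p) = mconst c * D (E p)" if "D \<in> L" "E \<in> L" for D E c p
    using that by (intro derivations_scale[of _ n]) (auto intro: der derivations_closed')
  then have sc': "D (E p * mconst c) = D (E p) * mconst c" if "D \<in> L" "E \<in> L" for D E c p
    using that by (simp only: mult.commute[of _ "mconst c"])
  have ad: "D (E p + F p) = D (E p) + D (F p)" "D (E p - F p) = D (E p) - D (F p)"
    if "D \<in> L" "E \<in> derivations n" "F \<in> derivations n" for D E F p
    using der[OF that(1)] that(2,3)
    by (simp_all add: derivations_add[of D n] derivations_diff[of D n] derivations_closed')
  have jd: "D (E (F p) - F (E p)) = D (E (F p)) - D (F (E p))" if "D \<in> L" "E \<in> L" "F \<in> L" for D E F p
    using that by (intro derivations_diff[of _ n]) (auto intro: der derivations_closed')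
  show ?thesis
  proof unfold_locales
    show "subspace L" by (rule sub)
    show "commutator x y \<in> L" if "x \<in> L" "y \<in> L" for x y using that by (rule closed)
  qed (auto simp: commutator_def op_scale_def fun_eq_iff z sc sc' ad der jd algebra_simps)
qed

lemma lie_algebra_derivations:
  "lie_algebra op_scale commutator (derivations n :: ('k::field mpoly \<Rightarrow> 'k mpoly) set)"
proof (rule lie_algebra_sub_derivations[OF order_refl _ commutator_derivations])
  interpret vector_space "op_scale :: 'k \<Rightarrow> _" by (rule vector_space_op_scale)
  show "subspace (derivations n)"
    by (auto simp: subspace_def derivations_def op_scale_def polys_add polys_mult algebra_simps)
qed

lemma \<uu>_subset_derivations: "\<uu> n \<subseteq> derivations n"
proof
  fix D :: "'k::comm_ring_1 mpoly \<Rightarrow> 'k mpoly" assume "D \<in> \<uu> n"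
  then obtain a where a: "\<forall>i\<in>{1..n}. a i \<in> polys (i - 1)"
    and D: "D = (\<lambda>p. \<Sum>i\<in>{1..n}. a i * partial_on n i p)" by (auto simp: \<uu>_def)
  have a': "a i \<in> polys n" if "i \<in> {1..n}" for i
    using a that by (intro polys_mono[of _ "i - 1" n]) auto
  have p: "partial_on n i p = partial_deriv i p" if "p \<in> polys n" for i and p :: "'k mpoly"
    using that by (simp add: partial_on_def)
  show "D \<in> derivations n"
    unfolding derivations_def mem_Collect_eq
  proof (intro conjI allI ballI impI)
    fix q :: "'k mpoly" assume "q \<notin> polys n"
    then show "D q = 0" by (simp add: D partial_on_def)
  next
    fix q :: "'k mpoly" assume "q \<in> polys n"
    then show "D q \<in> polys n"
      unfolding D by (intro polys_sum polys_mult) (simp_all add: a' p polys_partial_deriv)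
  next
    fix q r :: "'k mpoly" assume "q \<in> polys n" "r \<in> polys n"
    then show "D (q + r) = D q + D r" "D (q * r) = D q * r + q * D r"
      by (simp_all add: D p polys_add polys_mult partial_deriv_add partial_deriv_mult
          algebra_simps sum.distrib sum_distrib_left)
  next
    fix c and q :: "'k mpoly" assume "q \<in> polys n"
    then show "D (mconst c * q) = mconst c * D q"
      by (simp add: D p polys_mult partial_deriv_mult algebra_simps sum_distrib_left)
  qed
qed

lemma commutator_\<uu>:
  assumes "D \<in> \<uu> n" "E \<in> \<uu> n" shows "commutator D E \<in> \<uu> n"
proof -
  from assms obtain a b where a: "\<forall>i\<in>{1..n}. a i \<in> polys (i - 1)"
    and D: "D = (\<lambda>p. \<Sum>i\<in>{1..n}. a i * partial_on n i p)"
    and b: "\<forall>i\<in>{1..n}. b i \<in> polys (i - 1)"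
    and E: "E = (\<lambda>p. \<Sum>i\<in>{1..n}. b i * partial_on n i p)"
    unfolding \<uu>_def by blast
  define c where "c j = (\<Sum>i\<in>{1..n}. a i * partial_deriv i (b j) - b i * partial_deriv i (a j))" for j
  have t: "f i * partial_deriv i (g j) \<in> polys (j - 1)"
    if "i \<in> {1..n}" "j \<in> {1..n}" "\<forall>i\<in>{1..n}. f i \<in> polys (i - 1)" "\<forall>i\<in>{1..n}. g i \<in> polys (i - 1)"
    for i j and f g :: "nat \<Rightarrow> 'a mpoly"
  proof (cases "i < j")
    case True
    then have "f i \<in> polys (j - 1)" using that by (intro polys_mono[of _ "i - 1" "j - 1"]) auto
    then show ?thesis using that by (intro polys_mult polys_partial_deriv) auto
  next
    case False
    then have "j - 1 < i" using that by auto
    then show ?thesis using that partial_deriv_eq_0[of "g j" "j - 1" i] by simp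
  qed
  have c: "\<forall>j\<in>{1..n}. c j \<in> polys (j - 1)"
    using a b unfolding c_def by (intro ballI polys_sum polys_diff t) auto
  have p: "partial_on n i p = partial_deriv i p" if "p \<in> polys n" for i and p :: "'a mpoly"
    using that by (simp add: partial_on_def)
  have "commutator D E = (\<lambda>p. \<Sum>j\<in>{1..n}. c j * partial_on n j p)"
  proof
    fix q
    have DE: "D \<in> derivations n" "E \<in> derivations n"
      using assms \<uu>_subset_derivations by blast+
    show "commutator D E q = (\<Sum>j\<in>{1..n}. c j * partial_on n j q)"
    proof (cases "q \<in> polys n")
      case False
      with commutator_derivations[OF DE] show ?thesis
        by (simp add: derivations_eq_0 partial_on_def)
    next
      case True
      have Dq: "E q \<in> polys n" "D q \<in> polys n" using DE by (auto intro: derivations_closed')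
      have x: "(\<Sum>i\<in>{1..n}. f i * partial_deriv i (\<Sum>j\<in>{1..n}. g j * partial_deriv j q))
        = (\<Sum>j\<in>{1..n}. \<Sum>i\<in>{1..n}. f i * partial_deriv i (g j) * partial_deriv j q)
        + (\<Sum>i\<in>{1..n}. \<Sum>j\<in>{1..n}. f i * g j * partial_deriv i (partial_deriv j q))"
        for f g :: "nat \<Rightarrow> 'a mpoly"
        by (subst sum.swap[of "\<lambda>j i. f i * partial_deriv i (g j) * partial_deriv j q"])
           (simp add: partial_deriv_sum partial_deriv_mult sum_distrib_left sum.distrib algebra_simps)
      have y: "(\<Sum>i\<in>{1..n}. \<Sum>j\<in>{1..n}. a i * b j * partial_deriv i (partial_deriv j q))
        = (\<Sum>i\<in>{1..n}. \<Sum>j\<in>{1..n}. b i * a j * partial_deriv i (partial_deriv j q))"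
        by (subst sum.swap) (simp add: partial_deriv_commute mult.commute)
      have "commutator D E q = D (E q) - E (D q)" by (simp add: commutator_def)
      also have "D (E q) = (\<Sum>i\<in>{1..n}. a i * partial_deriv i (\<Sum>j\<in>{1..n}. b j * partial_deriv j q))"
        using Dq True by (subst D) (simp add: p E)
      also have "E (D q) = (\<Sum>i\<in>{1..n}. b i * partial_deriv i (\<Sum>j\<in>{1..n}. a j * partial_deriv j q))"
        using Dq True by (subst E) (simp add: p D)
      finally show ?thesis
        unfolding x y by (simp add: c_def p True sum_distrib_right left_diff_distrib sum_subtractf)
    qed
  qed
  with c show ?thesis unfolding \<uu>_def by blast
qed

lemma lie_algebra_\<uu>:
  "lie_algebra op_scale commutator (\<uu> n :: ('k::field mpoly \<Rightarrow> 'k mpoly) set)"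
proof (rule lie_algebra_sub_derivations[OF \<uu>_subset_derivations _ commutator_\<uu>])
  interpret vector_space "op_scale :: 'k \<Rightarrow> _" by (rule vector_space_op_scale)
  show "subspace (\<uu> n)"
    unfolding subspace_def
  proof (intro conjI ballI allI)
    show "0 \<in> \<uu> n"
      unfolding \<uu>_def by (auto intro!: exI[of _ "\<lambda>_. 0"] simp: fun_eq_iff)
  next
    fix D E :: "'k mpoly \<Rightarrow> 'k mpoly" assume "D \<in> \<uu> n" "E \<in> \<uu> n"
    then obtain a b where "\<forall>i\<in>{1..n}. a i \<in> polys (i - 1)"
      and "D = (\<lambda>p. \<Sum>i\<in>{1..n}. a i * partial_on n i p)"
      and "\<forall>i\<in>{1..n}. b i \<in> polys (i - 1)"
      and "E = (\<lambda>p. \<Sum>i\<in>{1..n}. b i * partial_on n i p)"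
      unfolding \<uu>_def by blast
    then show "D + E \<in> \<uu> n"
      unfolding \<uu>_def
      by (auto intro!: exI[of _ "\<lambda>i. a i + b i"] simp: fun_eq_iff polys_add sum.distrib algebra_simps)
  next
    fix c and D :: "'k mpoly \<Rightarrow> 'k mpoly" assume "D \<in> \<uu> n"
    then obtain a where "\<forall>i\<in>{1..n}. a i \<in> polys (i - 1)"
      and "D = (\<lambda>p. \<Sum>i\<in>{1..n}. a i * partial_on n i p)"
      unfolding \<uu>_def by blast
    then show "op_scale c D \<in> \<uu> n"
      unfolding \<uu>_def op_scale_def
      by (auto intro!: exI[of _ "\<lambda>i. mconst c * a i"] simp: fun_eq_iff polys_mult sum_distrib_left
          mult.assoc)
  qed
qed

end

theory Submission
  imports Defs "HOL-Library.List_Lenlexorder"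
begin

text \<open>
  Write an element of \<open>\<uu> n\<close> as a combination of the basis fields \<open>x\<^sup>m \<partial>\<^sub>i\<close>, where \<open>x\<^sup>m\<close> is a monomial in
  the variables \<open>x\<^sub>1, \<dots>, x\<^bsub>i-1\<^esub>\<close>. Well-order this basis: \<open>x\<^sup>m \<partial>\<^sub>i\<close> is smaller than \<open>x\<^bsup>m'\<^esup> \<partial>\<^sub>j\<close> if
  \<open>i > j\<close>, or if \<open>i = j\<close> and \<open>m\<close> is smaller than \<open>m'\<close> in the lexicographic order in which the
  variable of highest index is the most significant. Every nonzero \<open>D\<close> has a leading term, the
  largest basis field that occurs in it.

  The heart of the proof is that an ideal containing \<open>D \<noteq> 0\<close> contains every element whose
  leading term is at most that of \<open>D\<close> (\<open>ideal_absorbs_lower\<close>). By well-founded induction and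
  cancellation of leading terms, it is enough to see that the leading terms below that of \<open>D\<close> are
  cofinally reached by brackets \<open>[X, D]\<close> (\<open>ex_bracket_lead_between\<close>). Let \<open>x\<^sup>\<alpha> \<partial>\<^sub>i\<close> be the leading
  term of \<open>D\<close>.

  \<^item> If \<open>\<alpha> \<noteq> 0\<close>, let \<open>k\<close> be the least index with \<open>\<alpha>\<^sub>k > 0\<close>. Bracketing with \<open>x\<^sup>\<beta> \<partial>\<^sub>k\<close> differentiates
    all coefficients by \<open>x\<^sub>k\<close> and multiplies them by \<open>x\<^sup>\<beta>\<close>, which respects the order, so that the
    new leading term is \<open>x\<^bsup>\<alpha> - e\<^sub>k + \<beta>\<^esup> \<partial>\<^sub>i\<close>; the exponents \<open>\<beta>\<close> in the variables below \<open>x\<^sub>k\<close> are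
    arbitrary, and these fields are cofinal below \<open>x\<^sup>\<alpha> \<partial>\<^sub>i\<close>. The characteristic enters here: the
    derivative of a monomial by a variable that occurs in it must not vanish.
  \<^item> If \<open>\<alpha> = 0\<close> and \<open>i < n\<close>, bracketing with \<open>x\<^sup>\<gamma> x\<^sub>i \<partial>\<^bsub>i+1\<^esub>\<close> gives the leading term
    \<open>x\<^sup>\<gamma> \<partial>\<^bsub>i+1\<^esub>\<close> for every monomial \<open>x\<^sup>\<gamma>\<close> in \<open>x\<^sub>1, \<dots>, x\<^sub>i\<close>.
  \<^item> If \<open>\<alpha> = 0\<close> and \<open>i = n\<close>, nothing lies below \<open>\<partial>\<^sub>n\<close>.

  Hence the ideals form a chain, and a strictly decreasing sequence of ideals would
  yield a strictly decreasing sequence of leading terms. An automorphism \<open>\<sigma>\<close> that moves an ideal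
  \<open>I\<close> makes it strictly smaller or strictly larger, and then the powers of \<open>\<sigma>\<close> or of its inverse
  produce such a sequence (\<open>ideals_characteristic_if_ranked\<close>).
\<close>

section \<open>Lie algebras whose ideals are ranked by a well-order\<close>

context lie_algebra
begin

lemma zero_in_L: "0 \<in> L"
  using subspace_L by (simp add: subspace_def)

lemma lie_automorphismD:
  assumes "lie_automorphism \<sigma>"
  shows "bij_betw \<sigma> L L" and "inj_on \<sigma> L" and "\<sigma> ` L = L"
    and "\<And>x. x \<in> L \<Longrightarrow> \<sigma> x \<in> L"
    and "\<And>x y. x \<in> L \<Longrightarrow> y \<in> L \<Longrightarrow> \<sigma> (x + y) = \<sigma> x + \<sigma> y"
    and "\<And>c x. x \<in> L \<Longrightarrow> \<sigma> (scale c x) = scale c (\<sigma> x)"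
    and "\<And>x y. x \<in> L \<Longrightarrow> y \<in> L \<Longrightarrow> \<sigma> (bracket x y) = bracket (\<sigma> x) (\<sigma> y)"
  using assms by (auto simp: lie_automorphism_def bij_betw_def)

lemma lie_automorphism_inv_into:
  assumes \<sigma>: "lie_automorphism \<sigma>"
  shows "lie_automorphism (inv_into L \<sigma>)"
proof -
  note * = lie_automorphismD[OF \<sigma>]
  let ?\<tau> = "inv_into L \<sigma>"
  have \<tau>: "?\<tau> x \<in> L" "\<sigma> (?\<tau> x) = x" if "x \<in> L" for x
    using that *(3) by (auto intro: inv_into_into f_inv_into_f)
  have eq: "?\<tau> x = y" if "y \<in> L" "\<sigma> y = x" for x y
    using that *(2) by auto
  show ?thesis
    unfolding lie_automorphism_def
    using bij_betw_inv_into[OF *(1)] subspace_L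
    by (auto intro!: eq bracket_closed simp: \<tau> * subspace_def)
qed

lemma lie_ideal_image:
  assumes \<sigma>: "lie_automorphism \<sigma>" and I: "lie_ideal I"
  shows "lie_ideal (\<sigma> ` I)"
proof -
  note * = lie_automorphismD[OF \<sigma>]
  have IL: "x \<in> L" if "x \<in> I" for x using I that by (auto simp: lie_ideal_def)
  have sub: "subspace I" using I by (simp add: lie_ideal_def)
  have 0: "\<sigma> 0 = 0" using *(5)[OF zero_in_L zero_in_L] by simp
  have "subspace (\<sigma> ` I)"
    unfolding subspace_def
  proof (intro conjI ballI allI)
    show "0 \<in> \<sigma> ` I" using 0 sub by (force simp: subspace_def)
    show "x + y \<in> \<sigma> ` I" if "x \<in> \<sigma> ` I" "y \<in> \<sigma> ` I" for x y
      using that sub by (force simp: subspace_def *(5)[symmetric] IL)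
    show "scale c x \<in> \<sigma> ` I" if "x \<in> \<sigma> ` I" for c x
      using that sub by (force simp: subspace_def *(6)[symmetric] IL)
  qed
  moreover have "bracket x y \<in> \<sigma> ` I" if "x \<in> L" "y \<in> \<sigma> ` I" for x y
  proof -
    from that *(3) obtain x' y' where "x' \<in> L" "x = \<sigma> x'" "y' \<in> I" "y = \<sigma> y'" by blast
    then show ?thesis
      using I by (auto simp: *(7)[symmetric] IL lie_ideal_def)
  qed
  ultimately show ?thesis
    using IL *(4) by (auto simp: lie_ideal_def)
qed

text \<open>The hypothesis says that an ideal is determined by the ranks of its nonzero elements and that
  those ranks are closed downwards, so the ideals inherit comparability and the descending chain
  condition from the well-order. An order automorphism of such a chain is the identity.\<close>
lemma ideals_characteristic_if_ranked:
  fixes r :: "'v \<Rightarrow> 'w::wellorder"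
  assumes r: "\<And>J x y. \<lbrakk>lie_ideal J; x \<in> J; x \<noteq> 0; y \<in> L; y \<noteq> 0; r y \<le> r x\<rbrakk> \<Longrightarrow> y \<in> J"
    and I: "lie_ideal I"
  shows "characteristic_ideal I"
proof -
  have JL: "J \<subseteq> L" "0 \<in> J" if "lie_ideal J" for J
    using that by (auto simp: lie_ideal_def subspace_def)
  \<comment> \<open>If \<open>x \<in> J\<close> were outside \<open>\<sigma> ` J\<close>, then \<open>\<sigma> x\<close> would be an element of \<open>\<sigma> ` J\<close> outside
    \<open>\<sigma> ` \<sigma> ` J\<close>. Its rank would be smaller, since an element of \<open>\<sigma> ` J\<close> of rank at least \<open>r x\<close>
    would force \<open>x\<close> into \<open>\<sigma> ` J\<close>. This is an infinite descent.\<close>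
  have no_shrink: "x \<in> \<sigma> ` J"
    if "lie_automorphism \<sigma>" "lie_ideal J" "\<sigma> ` J \<subseteq> J" "x \<in> J" for \<sigma> J x
    using that(2-4)
  proof (induction "r x" arbitrary: x J rule: less_induct)
    case less
    note \<sigma> = lie_automorphismD[OF that(1)]
    have ideal: "lie_ideal (\<sigma> ` J)" using that(1) less.prems(1) by (rule lie_ideal_image)
    show ?case
    proof (rule ccontr)
      assume x: "x \<notin> \<sigma> ` J"
      have "x \<in> L" using less.prems JL by blast
      have "\<sigma> x \<noteq> 0"
      proof
        assume "\<sigma> x = 0"
        moreover have "\<sigma> 0 = 0" using \<sigma>(5)[OF zero_in_L zero_in_L] by simp
        ultimately have "x = 0" using inj_onD[OF \<sigma>(2)] \<open>x \<in> L\<close> zero_in_L by metis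
        with x JL(2)[OF ideal] show False by simp
      qed
      have "r (\<sigma> x) < r x"
      proof (rule ccontr)
        assume "\<not> r (\<sigma> x) < r x"
        moreover have "x \<noteq> 0" "\<sigma> x \<in> \<sigma> ` J" using x JL(2)[OF ideal] less.prems by auto
        ultimately show False
          using r[OF ideal, of "\<sigma> x" x] x \<open>\<sigma> x \<noteq> 0\<close> \<open>x \<in> L\<close> by (simp add: not_less)
      qed
      then have "\<sigma> x \<in> \<sigma> ` (\<sigma> ` J)"
        using less.hyps[of "\<sigma> x" "\<sigma> ` J"] ideal less.prems by blast
      then obtain z where "z \<in> \<sigma> ` J" "\<sigma> x = \<sigma> z" by blast
      with \<sigma>(2) \<open>x \<in> L\<close> JL(1)[OF ideal] have "x \<in> \<sigma> ` J" by (auto dest!: inj_onD)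
      with x show False ..
    qed
  qed
  have chain: "J \<subseteq> J' \<or> J' \<subseteq> J" if J: "lie_ideal J" "lie_ideal J'" for J J'
  proof (rule ccontr)
    assume "\<not> ?thesis"
    then obtain x y where "x \<in> J" "x \<notin> J'" "y \<in> J'" "y \<notin> J" by blast
    with r[OF J(1), of x y] r[OF J(2), of y x] JL J show False
      by (metis linear subsetD)
  qed
  have "\<sigma> ` I = I" if \<sigma>: "lie_automorphism \<sigma>" for \<sigma>
  proof (cases "\<sigma> ` I \<subseteq> I")
    case True
    with no_shrink[OF \<sigma> I] show ?thesis by blast
  next
    case False
    let ?\<tau> = "inv_into L \<sigma>"
    note * = lie_automorphismD[OF \<sigma>]
    have "I \<subseteq> \<sigma> ` I" using False chain[OF I lie_ideal_image[OF \<sigma> I]] by blast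
    then have "?\<tau> ` I \<subseteq> ?\<tau> ` \<sigma> ` I" by (rule image_mono)
    also have "?\<tau> ` \<sigma> ` I = I" using inv_into_image_cancel[OF *(2) JL(1)[OF I]] .
    finally have "I \<subseteq> ?\<tau> ` I" using no_shrink[OF lie_automorphism_inv_into[OF \<sigma>] I] by blast
    then have "\<sigma> ` I \<subseteq> \<sigma> ` ?\<tau> ` I" by (rule image_mono)
    also have "\<sigma> ` ?\<tau> ` I = I" using *(3) JL(1)[OF I] image_inv_into_cancel by metis
    finally show ?thesis using \<open>I \<subseteq> \<sigma> ` I\<close> by blast
  qed
  with I show ?thesis by (simp add: characteristic_ideal_def)
qed

end

section \<open>The well-order on the monomial vector fields\<close>

text \<open>The pair \<open>(i, m)\<close> stands for the basis field \<open>x\<^sup>m \<partial>\<^sub>i\<close>. Its code is a list of the fixed length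
  \<open>max 1 n\<close>, most significant entry first, so that the length-lexicographic order, a well-order, compares
  codes lexicographically. Fields along a \<open>\<partial>\<^sub>i\<close> of lower index are larger, whence the entry \<open>n - i\<close>.\<close>
definition term_code :: "nat \<Rightarrow> nat \<times> (nat \<Rightarrow>\<^sub>0 nat) \<Rightarrow> nat list" where
  "term_code n t = (n - fst t) # map (Poly_Mapping.lookup (snd t)) (rev [1..<n])"

lemma map_rev_upt_less_iff:
  fixes f g :: "nat \<Rightarrow> nat"
  shows "map f (rev [1..<n]) < map g (rev [1..<n]) \<longleftrightarrow>
    (\<exists>l\<in>{1..<n}. f l < g l \<and> (\<forall>l'\<in>{l<..<n}. f l' = g l'))"
proof (induction n)
  case (Suc n)
  show ?case
  proof (cases "n = 0")
    case False
    then have "[1..<Suc n] = [1..<n] @ [n]" by simp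
    then have "map f (rev [1..<Suc n]) < map g (rev [1..<Suc n]) \<longleftrightarrow>
      f n < g n \<or> f n = g n \<and> (\<exists>l\<in>{1..<n}. f l < g l \<and> (\<forall>l'\<in>{l<..<n}. f l' = g l'))"
      by (simp only: rev_append rev.simps append.simps list.map Cons_less_Cons Suc.IH)
         simp
    also have "\<dots> \<longleftrightarrow> (\<exists>l\<in>{1..<Suc n}. f l < g l \<and> (\<forall>l'\<in>{l<..<Suc n}. f l' = g l'))"
      (is "?a \<longleftrightarrow> ?b")
    proof
      assume ?a
      then show ?b
      proof
        assume "f n < g n"
        with False show ?b by (intro bexI[of _ n]) auto
      next
        assume "f n = g n \<and> (\<exists>l\<in>{1..<n}. f l < g l \<and> (\<forall>l'\<in>{l<..<n}. f l' = g l'))"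
        then obtain l where "f n = g n" "l \<in> {1..<n}" "f l < g l" "\<forall>l'\<in>{l<..<n}. f l' = g l'"
          by blast
        then show ?b by (intro bexI[of _ l]) (auto simp: less_Suc_eq)
      qed
    next
      assume ?b
      then obtain l where l: "l \<in> {1..<Suc n}" "f l < g l" "\<forall>l'\<in>{l<..<Suc n}. f l' = g l'" by blast
      then show ?a by (cases "l = n") auto
    qed
    finally show ?thesis .
  qed simp
qed simp

lemma term_code_less_iff:
  assumes "i \<le> n" "j \<le> n"
  shows "term_code n (i, m) < term_code n (j, m') \<longleftrightarrow>
    j < i \<or> i = j \<and> (\<exists>l\<in>{1..<n}. Poly_Mapping.lookup m l < Poly_Mapping.lookup m' l \<and>
      (\<forall>l'\<in>{l<..<n}. Poly_Mapping.lookup m l' = Poly_Mapping.lookup m' l'))"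
proof -
  have "n - i < n - j \<longleftrightarrow> j < i" "n - i = n - j \<longleftrightarrow> i = j" using assms by auto
  then show ?thesis
    by (simp only: term_code_def Cons_less_Cons map_rev_upt_less_iff) simp
qed

lemma term_code_inj:
  assumes "i \<le> n" "j \<le> n" "Poly_Mapping.keys m \<subseteq> {1..<n}" "Poly_Mapping.keys m' \<subseteq> {1..<n}"
    and "term_code n (i, m) = term_code n (j, m')"
  shows "i = j \<and> m = m'"
proof -
  have "Poly_Mapping.lookup m l = Poly_Mapping.lookup m' l" for l
  proof (cases "l \<in> {1..<n}")
    case True
    then show ?thesis using assms(5) by (auto simp: term_code_def)
  next
    case False
    then have "l \<notin> Poly_Mapping.keys m" "l \<notin> Poly_Mapping.keys m'" using assms by auto
    then show ?thesis by (simp add: in_keys_iff)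
  qed
  with assms show ?thesis by (auto simp: term_code_def intro: poly_mapping_eqI)
qed

lemma term_code_add_less_iff:
  assumes "i \<le> n" "j \<le> n"
  shows "term_code n (i, m + \<delta>) < term_code n (j, m' + \<delta>) \<longleftrightarrow> term_code n (i, m) < term_code n (j, m')"
  using assms by (simp add: term_code_less_iff lookup_add)

section \<open>Coefficients of triangular vector fields\<close>

definition mvar :: "nat \<Rightarrow> 'k::comm_ring_1 mpoly" where
  "mvar i = Poly_Mapping.single (Poly_Mapping.single i 1) 1"

definition monomial_field :: "nat \<Rightarrow> nat \<Rightarrow> (nat \<Rightarrow>\<^sub>0 nat) \<Rightarrow> 'k::comm_ring_1 mpoly \<Rightarrow> 'k mpoly" where
  "monomial_field n k \<beta> = (\<lambda>p. Poly_Mapping.single \<beta> 1 * partial_on n k p)"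

lemma single_in_polys: "Poly_Mapping.keys m \<subseteq> {1..i} \<Longrightarrow> Poly_Mapping.single m c \<in> polys i"
  by (auto simp: polys_def)

lemma mvar_in_polys: "i \<in> {1..n} \<Longrightarrow> mvar i \<in> polys n"
  by (simp add: mvar_def single_in_polys)

lemma partial_deriv_mvar: "partial_deriv i (mvar j) = (if i = j then 1 else 0)"
  by (auto simp: mvar_def partial_deriv_single lookup_single when_def simp flip: One_nat_def)

lemma \<uu>E:
  assumes "D \<in> \<uu> n"
  obtains a where "\<And>i. i \<in> {1..n} \<Longrightarrow> a i \<in> polys (i - 1)"
    and "D = (\<lambda>p. \<Sum>i\<in>{1..n}. a i * partial_on n i p)"
  using assms unfolding \<uu>_def by blast

lemma sum_partial_on_mvar:
  assumes "j \<in> {1..n}"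
  shows "(\<Sum>i\<in>{1..n}. a i * partial_on n i (mvar j)) = a j"
proof -
  have "(\<Sum>i\<in>{1..n}. a i * partial_on n i (mvar j)) = (\<Sum>i\<in>{1..n}. if i = j then a j else 0)"
    using mvar_in_polys[OF assms]
    by (intro sum.cong) (auto simp: partial_on_def partial_deriv_mvar)
  with assms show ?thesis by simp
qed

lemma \<uu>_mvar_in_polys: "D \<in> \<uu> n \<Longrightarrow> i \<in> {1..n} \<Longrightarrow> D (mvar i) \<in> polys (i - 1)"
  by (erule \<uu>E) (simp add: sum_partial_on_mvar del: One_nat_def)

text \<open>The coefficient of \<open>\<partial>\<^sub>i\<close> is recovered as the value at \<open>x\<^sub>i\<close>.\<close>
lemma \<uu>_apply: "D \<in> \<uu> n \<Longrightarrow> D p = (\<Sum>i\<in>{1..n}. D (mvar i) * partial_on n i p)"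
  by (erule \<uu>E) (simp add: sum_partial_on_mvar del: One_nat_def)

lemma monomial_field_in_\<uu>:
  assumes "k \<in> {1..n}" "Poly_Mapping.keys \<beta> \<subseteq> {1..k - 1}"
  shows "(monomial_field n k \<beta> :: 'k::comm_ring_1 mpoly \<Rightarrow> 'k mpoly) \<in> \<uu> n"
proof -
  define a :: "nat \<Rightarrow> 'k mpoly" where "a i = (if i = k then Poly_Mapping.single \<beta> 1 else 0)" for i
  have "monomial_field n k \<beta> = (\<lambda>p. \<Sum>i\<in>{1..n}. a i * partial_on n i p)"
  proof
    fix p
    have "(\<Sum>i\<in>{1..n}. a i * partial_on n i p) =
        (\<Sum>i\<in>{1..n}. if i = k then Poly_Mapping.single \<beta> 1 * partial_on n k p else 0)"
      by (intro sum.cong) (auto simp: a_def)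
    with assms show "monomial_field n k \<beta> p = (\<Sum>i\<in>{1..n}. a i * partial_on n i p)"
      by (simp add: monomial_field_def)
  qed
  moreover have "\<forall>i\<in>{1..n}. a i \<in> polys (i - 1)"
    using assms(2) by (simp add: a_def single_in_polys del: One_nat_def)
  ultimately show ?thesis unfolding \<uu>_def by blast
qed

lemma keys_single_mult:
  fixes p :: "'k::comm_ring_1 mpoly"
  shows "Poly_Mapping.keys (Poly_Mapping.single \<beta> 1 * p) = (+) \<beta> ` Poly_Mapping.keys p"
proof -
  have "Poly_Mapping.single \<beta> 1 * p =
      (\<Sum>m\<in>Poly_Mapping.keys p. Poly_Mapping.single (\<beta> + m) (Poly_Mapping.lookup p m))"
    by (subst mpoly_sum_singles[of p]) (simp add: sum_distrib_left mult_single)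
  then have *: "Poly_Mapping.lookup (Poly_Mapping.single \<beta> 1 * p) x =
      (\<Sum>m\<in>Poly_Mapping.keys p. if \<beta> + m = x then Poly_Mapping.lookup p m else 0)" for x
    by (simp add: lookup_sum lookup_single when_def)
  have shift: "Poly_Mapping.lookup (Poly_Mapping.single \<beta> 1 * p) (\<beta> + m) = Poly_Mapping.lookup p m" for m
    by (simp add: * in_keys_iff)
  have "Poly_Mapping.lookup (Poly_Mapping.single \<beta> 1 * p) x = 0"
    if "x \<notin> (+) \<beta> ` Poly_Mapping.keys p" for x
    unfolding * using that by (intro sum.neutral) auto
  then show ?thesis by (auto simp: in_keys_iff shift)
qed

text \<open>In characteristic zero no exponent becomes zero as a scalar, so a derivative loses only the
  monomials that are free of the variable.\<close>
lemma keys_partial_deriv: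
  fixes p :: "'k::field_char_0 mpoly"
  shows "Poly_Mapping.keys (partial_deriv k p) = {m. m + Poly_Mapping.single k 1 \<in> Poly_Mapping.keys p}"
  by (auto simp: in_keys_iff lookup_partial_deriv simp del: of_nat_Suc)

section \<open>Leading terms\<close>

definition vf_terms :: "nat \<Rightarrow> ('k::comm_ring_1 mpoly \<Rightarrow> 'k mpoly) \<Rightarrow> (nat \<times> (nat \<Rightarrow>\<^sub>0 nat)) set" where
  "vf_terms n D = (SIGMA i:{1..n}. Poly_Mapping.keys (D (mvar i)))"

text \<open>Meaningful for \<open>D \<noteq> 0\<close> only: the maximum of the empty set is unspecified.\<close>
definition lead_code :: "nat \<Rightarrow> ('k::comm_ring_1 mpoly \<Rightarrow> 'k mpoly) \<Rightarrow> nat list" where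
  "lead_code n D = Max (term_code n ` vf_terms n D)"

lemma finite_vf_terms: "finite (vf_terms n D)"
  by (simp add: vf_terms_def)

lemma vf_terms_keys:
  assumes "D \<in> \<uu> n" "(i, m) \<in> vf_terms n D"
  shows "i \<in> {1..n}" and "Poly_Mapping.keys m \<subseteq> {1..<i}"
proof -
  show i: "i \<in> {1..n}" using assms(2) by (simp add: vf_terms_def)
  then have "D (mvar i) \<in> polys (i - 1)" using assms(1) by (rule \<uu>_mvar_in_polys[rotated])
  with assms(2) have "Poly_Mapping.keys m \<subseteq> {1..i - 1}" by (auto simp: polys_def vf_terms_def)
  moreover have "{1..i - 1} = {1..<i}" using i by auto
  ultimately show "Poly_Mapping.keys m \<subseteq> {1..<i}" by simp
qed

lemma vf_terms_eq_empty_iff: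
  assumes "D \<in> \<uu> n" shows "vf_terms n D = {} \<longleftrightarrow> D = 0"
proof
  assume "vf_terms n D = {}"
  then have "D (mvar i) = 0" if "i \<in> {1..n}" for i
    using that by (simp add: vf_terms_def Sigma_empty_iff del: One_nat_def)
  then show "D = 0" by (intro ext, subst \<uu>_apply[OF assms]) simp
qed (simp add: vf_terms_def)

lemma lead_code_eqI:
  assumes "t \<in> vf_terms n D" "\<And>t'. t' \<in> vf_terms n D \<Longrightarrow> term_code n t' \<le> term_code n t"
  shows "lead_code n D = term_code n t"
  unfolding lead_code_def using assms by (intro Max_eqI finite_imageI finite_vf_terms) auto

lemma lead_codeE:
  assumes "D \<in> \<uu> n" "D \<noteq> 0"
  obtains i m where "(i, m) \<in> vf_terms n D" "lead_code n D = term_code n (i, m)"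
    "\<And>t. t \<in> vf_terms n D \<Longrightarrow> term_code n t \<le> term_code n (i, m)"
proof -
  have "term_code n ` vf_terms n D \<noteq> {}" using vf_terms_eq_empty_iff assms by blast
  then have "lead_code n D \<in> term_code n ` vf_terms n D"
    unfolding lead_code_def by (intro Max_in finite_imageI finite_vf_terms)
  then obtain i m where im: "(i, m) \<in> vf_terms n D" "lead_code n D = term_code n (i, m)" by auto
  moreover have "term_code n t \<le> term_code n (i, m)" if "t \<in> vf_terms n D" for t
    using that unfolding im(2)[symmetric] lead_code_def
    by (intro Max_ge finite_imageI finite_vf_terms imageI)
  ultimately show thesis by (rule that)
qed

section \<open>Leading terms of brackets\<close>

lemma commutator_monomial_field_mvar:
  assumes "D \<in> \<uu> n" "j \<in> {1..n}"
  shows "commutator (monomial_field n k \<beta>) D (mvar j) =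
    Poly_Mapping.single \<beta> 1 * partial_deriv k (D (mvar j)) -
    (if j = k then D (Poly_Mapping.single \<beta> 1) else 0)"
proof -
  have D: "D \<in> derivations n" using assms(1) \<uu>_subset_derivations by blast
  with mvar_in_polys[OF assms(2)] show ?thesis
    by (auto simp: commutator_def monomial_field_def partial_on_def partial_deriv_mvar
        derivations_closed' derivations_0)
qed

text \<open>Only the derivatives by \<open>x\<^sub>1, \<dots>, x\<^bsub>k-1\<^esub>\<close> see a monomial in these variables.\<close>
lemma \<uu>_apply_monomial:
  fixes D :: "'k::comm_ring_1 mpoly \<Rightarrow> 'k mpoly"
  assumes "D \<in> \<uu> n" "k \<in> {1..n}" "Poly_Mapping.keys \<beta> \<subseteq> {1..k - 1}"
  shows "D (Poly_Mapping.single \<beta> 1) =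
    (\<Sum>i\<in>{1..<k}. D (mvar i) * partial_deriv i (Poly_Mapping.single \<beta> 1))"
proof -
  let ?p = "Poly_Mapping.single \<beta> 1 :: 'k mpoly"
  have \<beta>: "?p \<in> polys (k - 1)" using assms(3) by (rule single_in_polys)
  then have "?p \<in> polys n" by (rule polys_mono) (use assms in auto)
  then have "D ?p =
    (\<Sum>i\<in>{1..n}. D (mvar i) * partial_deriv i ?p)"
    by (subst \<uu>_apply[OF assms(1)]) (simp add: partial_on_def)
  also have "\<dots> = (\<Sum>i\<in>{1..<k}. D (mvar i) * partial_deriv i ?p)"
    using assms(2) partial_deriv_eq_0[OF \<beta>] by (intro sum.mono_neutral_right) auto
  finally show ?thesis .
qed

text \<open>Bracketing with \<open>x\<^sup>\<beta> \<partial>\<^sub>k\<close> when \<open>D\<close> only involves \<open>\<partial>\<^sub>j\<close> with \<open>j > k\<close>: then \<open>D\<close> kills \<open>x\<^sup>\<beta>\<close>, and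
  the bracket is the operator \<open>x\<^sup>\<beta> \<partial>\<^sub>k\<close> applied to each coefficient of \<open>D\<close>. So terms move by the
  translation \<open>\<beta> - e\<^sub>k\<close>, except those free of \<open>x\<^sub>k\<close>, which disappear.\<close>
lemma vf_terms_commutator_lower:
  fixes D :: "'k::field_char_0 mpoly \<Rightarrow> 'k mpoly"
  assumes D: "D \<in> \<uu> n" and k: "k \<in> {1..n}" and \<beta>: "Poly_Mapping.keys \<beta> \<subseteq> {1..k - 1}"
    and le: "\<And>j m. (j, m) \<in> vf_terms n D \<Longrightarrow> k < j"
  shows "vf_terms n (commutator (monomial_field n k \<beta>) D) =
    {(j, \<beta> + m) | j m. (j, m + Poly_Mapping.single k 1) \<in> vf_terms n D}"
proof -
  have zero: "D (mvar i) = 0" if "i \<in> {1..k}" for i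
    using that le[of i] k by (force simp: vf_terms_def)
  have "D (Poly_Mapping.single \<beta> 1) = 0"
    unfolding \<uu>_apply_monomial[OF D k \<beta>] by (intro sum.neutral) (auto simp: zero)
  then have "commutator (monomial_field n k \<beta>) D (mvar j) =
      Poly_Mapping.single \<beta> 1 * partial_deriv k (D (mvar j))" if "j \<in> {1..n}" for j
    using commutator_monomial_field_mvar[OF D that, of k \<beta>] by simp
  then have "Poly_Mapping.keys (commutator (monomial_field n k \<beta>) D (mvar j)) =
      (+) \<beta> ` {m. m + Poly_Mapping.single k 1 \<in> Poly_Mapping.keys (D (mvar j))}"
    if "j \<in> {1..n}" for j
    using that by (simp only: keys_single_mult keys_partial_deriv)
  then show ?thesis
    by (auto simp: vf_terms_def simp del: One_nat_def)
qed

text \<open>When the leading term of \<open>D\<close> is \<open>\<partial>\<^sub>i\<close>, bracketing with a field along \<open>\<partial>\<^bsub>i+1\<^esub>\<close> exploits the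
  other half of the commutator: \<open>D\<close> differentiates the coefficient \<open>x\<^sup>\<gamma> x\<^sub>i\<close> by \<open>x\<^sub>i\<close>, which leaves a
  nonzero multiple of \<open>x\<^sup>\<gamma> \<partial>\<^bsub>i+1\<^esub>\<close>. All remaining terms lie along \<open>\<partial>\<^sub>j\<close> with \<open>j > i + 1\<close> and are
  therefore smaller.\<close>
lemma lead_code_commutator_constant_lead:
  fixes D :: "'k::field_char_0 mpoly \<Rightarrow> 'k mpoly"
  assumes D: "D \<in> \<uu> n" and i: "1 \<le> i" "i < n" and \<gamma>: "Poly_Mapping.keys \<gamma> \<subseteq> {1..i}"
    and lead: "(i, 0) \<in> vf_terms n D"
    and le: "\<And>j m. (j, m) \<in> vf_terms n D \<Longrightarrow> i < j \<or> j = i \<and> m = 0"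
  defines "X \<equiv> monomial_field n (Suc i) (\<gamma> + Poly_Mapping.single i 1)"
  shows "X \<in> \<uu> n" and "lead_code n (commutator X D) = term_code n (Suc i, \<gamma>)"
    and "(Suc i, \<gamma>) \<in> vf_terms n (commutator X D)"
proof -
  let ?\<beta> = "\<gamma> + Poly_Mapping.single i 1"
  have \<beta>: "Poly_Mapping.keys ?\<beta> \<subseteq> {1..Suc i - 1}"
    using \<gamma> i Poly_Mapping.keys_add[of \<gamma> "Poly_Mapping.single i 1"] by fastforce
  have Suc_i: "Suc i \<in> {1..n}" using i by auto
  show "X \<in> \<uu> n" unfolding X_def using Suc_i \<beta> by (rule monomial_field_in_\<uu>)
  have zero: "D (mvar j) = 0" if "j \<in> {1..<i}" for j
    using that le[of j] i by (force simp: vf_terms_def)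
  have "Poly_Mapping.keys (D (mvar i)) \<subseteq> {0}" using le[of i] i by (auto simp: vf_terms_def)
  then have "D (mvar i) = mconst (Poly_Mapping.lookup (D (mvar i)) 0)"
    by (intro poly_mapping_eqI) (auto simp: lookup_single when_def in_keys_iff)
  then obtain c where const: "D (mvar i) = mconst c" by blast
  have c: "c \<noteq> 0" using lead by (auto simp: vf_terms_def const)
  have "D (Poly_Mapping.single ?\<beta> 1) = mconst c * partial_deriv i (Poly_Mapping.single ?\<beta> 1)"
    unfolding \<uu>_apply_monomial[OF D Suc_i \<beta>] using i
    by (simp add: atLeastLessThanSuc zero const)
  also have "\<dots> = Poly_Mapping.single \<gamma> (c * of_nat (Suc (Poly_Mapping.lookup \<gamma> i)))"
    by (simp add: partial_deriv_single mult_single lookup_add del: of_nat_Suc)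
  finally have DB: "D (Poly_Mapping.single ?\<beta> 1) = \<dots>" .
  have low: "partial_deriv (Suc i) (D (mvar j)) = 0" if "j \<in> {1..n}" "j \<le> Suc i" for j
    using \<uu>_mvar_in_polys[OF D that(1)] by (rule partial_deriv_eq_0) (use that in auto)
  have com: "commutator X D (mvar j) = (if j \<le> i then 0 else
      if j = Suc i then - Poly_Mapping.single \<gamma> (c * of_nat (Suc (Poly_Mapping.lookup \<gamma> i)))
      else Poly_Mapping.single ?\<beta> 1 * partial_deriv (Suc i) (D (mvar j)))" if "j \<in> {1..n}" for j
    unfolding X_def commutator_monomial_field_mvar[OF D that] using that low[OF that] DB by auto
  have nz: "c * of_nat (Suc (Poly_Mapping.lookup \<gamma> i)) \<noteq> 0"
    using c by (simp del: of_nat_Suc)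
  show in_terms: "(Suc i, \<gamma>) \<in> vf_terms n (commutator X D)"
    using com[OF Suc_i] Suc_i nz by (simp add: vf_terms_def del: of_nat_Suc)
  show "lead_code n (commutator X D) = term_code n (Suc i, \<gamma>)"
  proof (rule lead_code_eqI[OF in_terms])
    fix t assume "t \<in> vf_terms n (commutator X D)"
    then obtain j m where t: "t = (j, m)" "j \<in> {1..n}" "m \<in> Poly_Mapping.keys (commutator X D (mvar j))"
      by (auto simp: vf_terms_def)
    consider "Suc i < j" | "j = Suc i" "m = \<gamma>"
      using t(3) com[OF t(2)] nz by (force split: if_splits simp del: of_nat_Suc)
    then show "term_code n t \<le> term_code n (Suc i, \<gamma>)"
    proof cases
      case 1
      then have "term_code n t < term_code n (Suc i, \<gamma>)"
        using t Suc_i by (simp add: term_code_less_iff)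
      then show ?thesis by simp
    qed (simp add: t)
  qed
qed

text \<open>The leading terms of the brackets \<open>[X, D]\<close> are cofinal among the terms below the leading term of
  \<open>D\<close>. The field \<open>X\<close> is chosen according to whether the leading coefficient monomial of \<open>D\<close> is
  constant; in both cases it can be adjusted to the leading term of \<open>E\<close>.\<close>
lemma ex_bracket_lead_between:
  fixes D E :: "'k::field_char_0 mpoly \<Rightarrow> 'k mpoly"
  assumes D: "D \<in> \<uu> n" "D \<noteq> 0" and E: "E \<in> \<uu> n" "E \<noteq> 0"
    and less: "lead_code n E < lead_code n D"
  shows "\<exists>X\<in>\<uu> n. commutator X D \<noteq> 0 \<and>
    lead_code n E \<le> lead_code n (commutator X D) \<and> lead_code n (commutator X D) < lead_code n D"
proof -
  obtain i \<alpha> where i\<alpha>: "(i, \<alpha>) \<in> vf_terms n D" "lead_code n D = term_code n (i, \<alpha>)"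
    and max: "\<And>t. t \<in> vf_terms n D \<Longrightarrow> term_code n t \<le> term_code n (i, \<alpha>)"
    using lead_codeE[OF D] by blast
  obtain j \<gamma> where j\<gamma>: "(j, \<gamma>) \<in> vf_terms n E" "lead_code n E = term_code n (j, \<gamma>)"
    using lead_codeE[OF E] by blast
  note i = vf_terms_keys[OF D(1) i\<alpha>(1)] and j = vf_terms_keys[OF E(1) j\<gamma>(1)]
  note less' = less[unfolded i\<alpha>(2) j\<gamma>(2)]
  have ge_i: "i \<le> l" if "(l, m) \<in> vf_terms n D" for l m
    using max[OF that] vf_terms_keys(1)[OF D(1) that] i(1)
    by (auto simp: not_less[symmetric] term_code_less_iff)
  have nz: "commutator X D \<noteq> 0" if "t \<in> vf_terms n (commutator X D)" for X t
    using that by (auto simp: vf_terms_def)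
  show ?thesis
  proof (cases "\<alpha> = 0")
    case True
    have ij: "i < j" using less' i(1) j(1) by (auto simp: term_code_less_iff True)
    have low: "i < l \<or> l = i \<and> m = 0" if "(l, m) \<in> vf_terms n D" for l m
    proof (cases "l = i")
      case l: True
      have "m = 0"
      proof (rule ccontr)
        assume "m \<noteq> 0"
        have keys: "Poly_Mapping.keys m \<subseteq> {1..<n}" using vf_terms_keys[OF D(1) that] l by auto
        have "term_code n (i, m) \<noteq> term_code n (i, 0)"
          using term_code_inj[of i n i m 0] keys i(1) \<open>m \<noteq> 0\<close> by auto
        moreover have "\<not> term_code n (i, m) < term_code n (i, 0)"
          using i(1) by (simp add: term_code_less_iff)
        ultimately show False using max[OF that] l True by auto
      qed
      with l show ?thesis by simp
    qed (use ge_i[OF that] in auto)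
    \<comment> \<open>For \<open>j > i + 1\<close> every field along \<open>\<partial>\<^bsub>i+1\<^esub>\<close> lies above the leading term of \<open>E\<close>.\<close>
    define \<gamma>' where "\<gamma>' = (if j = Suc i then \<gamma> else 0)"
    have "Poly_Mapping.keys \<gamma>' \<subseteq> {1..i}" using j(2) by (auto simp: \<gamma>'_def)
    moreover have "1 \<le> i" "i < n" using i(1) j(1) ij by auto
    ultimately obtain X where X: "X \<in> \<uu> n" "lead_code n (commutator X D) = term_code n (Suc i, \<gamma>')"
        "(Suc i, \<gamma>') \<in> vf_terms n (commutator X D)"
      using lead_code_commutator_constant_lead[OF D(1), of i \<gamma>'] i\<alpha>(1) low True by blast
    have "term_code n (j, \<gamma>) \<le> term_code n (Suc i, \<gamma>')"
      using ij j(1) by (cases "j = Suc i") (auto simp: \<gamma>'_def term_code_less_iff intro!: less_imp_le)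
    moreover have "term_code n (Suc i, \<gamma>') < term_code n (i, \<alpha>)"
      using ij i(1) j(1) by (auto simp: term_code_less_iff)
    ultimately show ?thesis
      using X nz[OF X(3)] unfolding i\<alpha>(2) j\<gamma>(2) by (intro bexI[of _ X]) auto
  next
    case False
    define k where "k = (LEAST k. Poly_Mapping.lookup \<alpha> k \<noteq> 0)"
    have "\<exists>k. Poly_Mapping.lookup \<alpha> k \<noteq> 0"
      using False by (metis lookup_zero poly_mapping_eqI)
    then have k: "Poly_Mapping.lookup \<alpha> k \<noteq> 0" unfolding k_def by (rule LeastI_ex)
    have below_k: "Poly_Mapping.lookup \<alpha> l = 0" if "l < k" for l
      using not_less_Least[of l "\<lambda>k. Poly_Mapping.lookup \<alpha> k \<noteq> 0"] that by (auto simp: k_def)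
    have "k \<in> Poly_Mapping.keys \<alpha>" using k by (simp add: in_keys_iff)
    then have k_in: "k \<in> {1..<i}" using i(2) by blast
    then have k_in': "k \<in> {1..n}" "k \<in> {1..<n}" using i(1) by auto
    \<comment> \<open>As \<open>x\<^sup>\<gamma> \<partial>\<^sub>j\<close> is below \<open>x\<^sup>\<alpha> \<partial>\<^sub>i\<close>, of the fields \<open>x\<^bsup>\<alpha> - e\<^sub>k + \<beta>\<^esup> \<partial>\<^sub>i\<close>, those with \<open>\<beta>\<close> at least \<open>\<gamma>\<close> in the variables below
      \<open>x\<^sub>k\<close> are at least \<open>x\<^sup>\<gamma> \<partial>\<^sub>j\<close>; the simplest choice of \<open>\<beta>\<close> is \<open>\<gamma>\<close> itself there.\<close>
    define \<beta> where "\<beta> = (\<Sum>l\<in>{1..<k}. Poly_Mapping.single l (Poly_Mapping.lookup \<gamma> l))"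
    have \<beta>: "Poly_Mapping.lookup \<beta> l = (if l \<in> {1..<k} then Poly_Mapping.lookup \<gamma> l else 0)" for l
      by (simp add: \<beta>_def lookup_sum lookup_single when_def)
    have \<beta>_keys: "Poly_Mapping.keys \<beta> \<subseteq> {1..k - 1}" by (auto simp: in_keys_iff \<beta> split: if_splits)
    let ?X = "monomial_field n k \<beta> :: 'k mpoly \<Rightarrow> 'k mpoly"
    have X: "?X \<in> \<uu> n" using k_in'(1) \<beta>_keys by (rule monomial_field_in_\<uu>)
    have terms: "vf_terms n (commutator ?X D) =
        {(l, \<beta> + m) | l m. (l, m + Poly_Mapping.single k 1) \<in> vf_terms n D}"
      by (rule vf_terms_commutator_lower[OF D(1) k_in'(1) \<beta>_keys]) (use ge_i k_in in force)
    define \<alpha>' where "\<alpha>' = \<alpha> - Poly_Mapping.single k 1"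
    have \<alpha>: "\<alpha> = \<alpha>' + Poly_Mapping.single k 1"
      unfolding \<alpha>'_def using k
      by (intro poly_mapping_eqI) (auto simp: lookup_add lookup_minus lookup_single when_def)
    have in_terms: "(i, \<beta> + \<alpha>') \<in> vf_terms n (commutator ?X D)"
      unfolding terms using i\<alpha>(1) \<alpha> by auto
    have lead: "lead_code n (commutator ?X D) = term_code n (i, \<beta> + \<alpha>')"
    proof (rule lead_code_eqI[OF in_terms])
      fix t assume "t \<in> vf_terms n (commutator ?X D)"
      then obtain l m where t: "t = (l, \<beta> + m)" "(l, m + Poly_Mapping.single k 1) \<in> vf_terms n D"
        unfolding terms by blast
      have "l \<le> n" using vf_terms_keys(1)[OF D(1) t(2)] by simp
      moreover have "\<not> term_code n (i, \<alpha>' + Poly_Mapping.single k 1)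
          < term_code n (l, m + Poly_Mapping.single k 1)"
        using max[OF t(2)] \<alpha> by (simp add: not_less)
      ultimately have "\<not> term_code n (i, \<alpha>' + \<beta>) < term_code n (l, m + \<beta>)"
        using i(1) by (simp add: term_code_add_less_iff)
      then show "term_code n t \<le> term_code n (i, \<beta> + \<alpha>')"
        by (simp add: t(1) add.commute not_less)
    qed
    have val: "Poly_Mapping.lookup (\<beta> + \<alpha>') l = (if l < k then (if l = 0 then 0 else Poly_Mapping.lookup \<gamma> l)
        else if l = k then Poly_Mapping.lookup \<alpha> k - 1 else Poly_Mapping.lookup \<alpha> l)" for l
      using below_k[of l] by (auto simp: lookup_add \<beta> \<alpha>'_def lookup_minus lookup_single when_def)
    have "term_code n (i, \<beta> + \<alpha>') < term_code n (i, \<alpha>)"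
      using i(1) k_in'(2) k by (auto simp: term_code_less_iff val intro!: bexI[of _ k])
    moreover have "\<not> term_code n (i, \<beta> + \<alpha>') < term_code n (j, \<gamma>)"
    proof
      assume "term_code n (i, \<beta> + \<alpha>') < term_code n (j, \<gamma>)"
      with less' i(1) j(1) obtain l l' where
        l: "l \<in> {1..<n}" "Poly_Mapping.lookup \<gamma> l < Poly_Mapping.lookup \<alpha> l"
          "\<forall>p\<in>{l<..<n}. Poly_Mapping.lookup \<gamma> p = Poly_Mapping.lookup \<alpha> p" and
        l': "l' \<in> {1..<n}" "Poly_Mapping.lookup (\<beta> + \<alpha>') l' < Poly_Mapping.lookup \<gamma> l'"
          "\<forall>p\<in>{l'<..<n}. Poly_Mapping.lookup (\<beta> + \<alpha>') p = Poly_Mapping.lookup \<gamma> p"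
        unfolding term_code_less_iff[OF _ _, of i n j] by (auto simp: term_code_less_iff)
      have "k \<le> l" using below_k[of l] l(2) by (cases "l < k") auto
      have "k \<le> l'" using l'(1,2) by (cases "l' < k") (auto simp: val)
      consider "l < l'" | "l' < l" | "l' = l" by linarith
      then show False
      proof cases
        case 1
        with l(3) l' \<open>k \<le> l\<close> show False by (auto simp: val)
      next
        case 2
        with l l'(3) \<open>k \<le> l'\<close> show False by (auto simp: val)
      next
        case 3
        with l(2) l'(2) \<open>k \<le> l\<close> show False by (auto simp: val split: if_splits)
      qed
    qed
    ultimately show ?thesis
      using X lead nz[OF in_terms] unfolding i\<alpha>(2) j\<gamma>(2) by (intro bexI[of _ ?X]) (auto simp: not_less)
  qed
qed

section \<open>Ideals of \<open>\<uu> n\<close>\<close>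

text \<open>Elements with smaller leading term than \<open>D\<close> are absorbed through a bracket \<open>[X, D]\<close> in the ideal
  whose leading term lies in between. An \<open>E\<close> with the same leading term
  differs from a scalar multiple of \<open>D\<close> by such an element.\<close>
lemma ideal_absorbs_lower:
  fixes D E :: "'k::field_char_0 mpoly \<Rightarrow> 'k mpoly"
  assumes I: "lie_algebra.lie_ideal op_scale commutator (\<uu> n) I"
    and "D \<in> I" "D \<noteq> 0" "E \<in> \<uu> n" "E \<noteq> 0" "lead_code n E \<le> lead_code n D"
  shows "E \<in> I"
  using assms(2-)
proof (induction "lead_code n D" arbitrary: D E rule: less_induct)
  case less
  interpret lie_algebra op_scale commutator "\<uu> n :: ('k mpoly \<Rightarrow> 'k mpoly) set"
    by (rule lie_algebra_\<uu>)
  have sub: "subspace I" and bracket: "\<And>X D. X \<in> \<uu> n \<Longrightarrow> D \<in> I \<Longrightarrow> commutator X D \<in> I"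
    and I_sub: "I \<subseteq> \<uu> n"
    using I by (auto simp: lie_ideal_def)
  have D: "D \<in> \<uu> n" using less.prems I_sub by blast
  have strict: "F \<in> I" if F: "F \<in> \<uu> n" "F \<noteq> 0" "lead_code n F < lead_code n D" for F
  proof -
    obtain X where "X \<in> \<uu> n" "commutator X D \<noteq> 0" "lead_code n F \<le> lead_code n (commutator X D)"
      "lead_code n (commutator X D) < lead_code n D"
      using ex_bracket_lead_between[OF D less.prems(2) F] by blast
    with less.hyps[of "commutator X D" F] bracket less.prems(1) F show ?thesis by blast
  qed
  show ?case
  proof (cases "lead_code n E = lead_code n D")
    case False
    with strict less.prems show ?thesis by simp
  next
    case True
    obtain i m where im: "(i, m) \<in> vf_terms n D" "lead_code n D = term_code n (i, m)"
      and maxD: "\<And>t. t \<in> vf_terms n D \<Longrightarrow> term_code n t \<le> term_code n (i, m)"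
      using lead_codeE[OF D less.prems(2)] by blast
    obtain j m' where jm: "(j, m') \<in> vf_terms n E" "lead_code n E = term_code n (j, m')"
      and maxE: "\<And>t. t \<in> vf_terms n E \<Longrightarrow> term_code n t \<le> term_code n (j, m')"
      using lead_codeE[OF less.prems(3,4)] by blast
    let ?coeff = "\<lambda>F. Poly_Mapping.lookup (F (mvar i)) m :: 'k"
    define c where "c = ?coeff E / ?coeff D"
    define F where "F = E - op_scale c D"
    have "op_scale c D \<in> I" using sub less.prems(1) by (rule subspace_scale)
    then have F: "F \<in> \<uu> n"
      unfolding F_def using less.prems(3) I_sub subspace_L by (blast intro: subspace_diff)
    have "?coeff D \<noteq> 0" using im(1) by (auto simp: vf_terms_def in_keys_iff)
    have F_mvar: "F (mvar l) = E (mvar l) - mconst c * D (mvar l)" for l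
      by (simp add: F_def op_scale_def)
    have mconst_mult: "Poly_Mapping.lookup (mconst a * p) q = a * Poly_Mapping.lookup p q"
      for a and p :: "'k mpoly" and q
      by (simp flip: mult_map_scale_conv_mult add: map.rep_eq when_def)
    have F_terms: "vf_terms n F \<subseteq> vf_terms n E \<union> vf_terms n D"
      by (auto simp: vf_terms_def F_mvar in_keys_iff lookup_minus mconst_mult)
    have not_in: "(i, m) \<notin> vf_terms n F"
      using \<open>?coeff D \<noteq> 0\<close> by (simp add: vf_terms_def F_mvar in_keys_iff lookup_minus mconst_mult c_def)
    have "F \<in> I"
    proof (cases "F = 0")
      case True
      with sub show ?thesis by (simp add: subspace_0)
    next
      case False
      obtain l q where lq: "(l, q) \<in> vf_terms n F" "lead_code n F = term_code n (l, q)"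
        using lead_codeE[OF F False] by blast
      have "term_code n (l, q) \<le> term_code n (i, m)"
        using F_terms lq(1) maxD maxE True im(2) jm(2) by (metis UnE subsetD)
      moreover have "term_code n (l, q) \<noteq> term_code n (i, m)"
      proof
        assume eq: "term_code n (l, q) = term_code n (i, m)"
        have "l = i \<and> q = m"
          by (rule term_code_inj[OF _ _ _ _ eq])
             (use vf_terms_keys[OF F lq(1)] vf_terms_keys[OF D im(1)] in auto)
        with lq(1) not_in show False by simp
      qed
      ultimately show ?thesis using strict[OF F False] lq(2) im(2) by simp
    qed
    then have "F + op_scale c D \<in> I" using \<open>op_scale c D \<in> I\<close> sub by (blast intro: subspace_add)
    then show ?thesis by (simp add: F_def)
  qed
qed

theorem corollary3p7:
  fixes n :: nat and I :: "('k::field_char_0 mpoly \<Rightarrow> 'k mpoly) set"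
  assumes "n \<ge> 2"
    and "lie_algebra.lie_ideal op_scale commutator (\<uu> n) I"
  shows "lie_algebra.characteristic_ideal op_scale commutator (\<uu> n) I"
  using lie_algebra.ideals_characteristic_if_ranked[OF lie_algebra_\<uu> ideal_absorbs_lower assms(2)] .

end
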